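(* For all integers $r\ge d\ge 0$ we have $$ \gamma_r(d) \ge \sum_{j=0}^{d-1} \binom rj. $$ Equivalently, for all integers $r\ge d\ge 0$, $$ \beta_r(d) \le \sum_{j=0}^d \binom rj. $$
   Context: Let $\mathbb{F}_2^r$ be the $r$-dimensional vector space over the two-element field, and let $0\le d\le r$ be an integer. A subset $C\subseteq\mathbb{F}_2^r$ is called $d$-complete if for every $v\in\mathbb{F}_2^r$ there exists a linear subspace $L_v\le\mathbb{F}_2^r$ of dimension $d$ such that $v+(L_v\setminus\{0\})\subseteq C$. By $\gamma_r(d)$ we denote the smallest possible size of a $d$-complete subset of $\mathbb{F}_2^r$. A subset $B\subseteq\mathbb{F}_2^r$ is called $d$-non-blocking if for every $v\in\mathbb{F}_2^r$ there exists a linear subspace $L_v\le\mathbb{F}_2^r$ of codimension $d$ (that is, of dimension $r-d$) such that $(v+(L_v\setminus\{0\}))\cap B=\varnothing$. By $\beta_r(d)$ we denote the largest possible size of a $d$-non-blocking subset of $\mathbb{F}_2^r$. Taking complements, $\beta_r(d)=2^r-\gamma_r(r-d)$ for all $0\le d\le r$. An empty sum equals $0$. *)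

theory Defs
  imports Complex_Main "HOL-Library.Z2" "HOL-Library.Function_Algebras"
begin

text \<open>
  The space of dimension \<open>r\<close> over the two-element field is realised as the sequences over \<open>bit\<close>
  that vanish from index \<open>r\<close> on, rather than as \<open>bit ^ 'n\<close>, because \<open>r = 0\<close> must be allowed.
\<close>

definition F2 :: "nat \<Rightarrow> (nat \<Rightarrow> bit) set" where
  "F2 r = {x. \<forall>i\<ge>r. x i = 0}"

definition scale2 :: "bit \<Rightarrow> (nat \<Rightarrow> bit) \<Rightarrow> (nat \<Rightarrow> bit)" where
  "scale2 c x = (\<lambda>i. c * x i)"

global_interpretation F2: vector_space scale2
  by unfold_locales (auto simp: scale2_def fun_eq_iff algebra_simps)

definition complete2 :: "nat \<Rightarrow> nat \<Rightarrow> (nat \<Rightarrow> bit) set \<Rightarrow> bool" where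
  "complete2 r d C \<longleftrightarrow> C \<subseteq> F2 r \<and>
     (\<forall>v\<in>F2 r. \<exists>L. F2.subspace L \<and> L \<subseteq> F2 r \<and> F2.dim L = d \<and>
        (\<lambda>x. v + x) ` (L - {0}) \<subseteq> C)"

definition nonblocking2 :: "nat \<Rightarrow> nat \<Rightarrow> (nat \<Rightarrow> bit) set \<Rightarrow> bool" where
  "nonblocking2 r d B \<longleftrightarrow> B \<subseteq> F2 r \<and>
     (\<forall>v\<in>F2 r. \<exists>L. F2.subspace L \<and> L \<subseteq> F2 r \<and> F2.dim L = r - d \<and>
        (\<lambda>x. v + x) ` (L - {0}) \<inter> B = {})"

text \<open>
  The extrema below are taken over finite sets, which are nonempty for \<open>d \<le> r\<close>
  (lemmas \<open>gamma2_attained\<close> and \<open>beta2_attained\<close>).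
\<close>

definition gamma2 :: "nat \<Rightarrow> nat \<Rightarrow> nat" where
  "gamma2 r d = Min {card C | C. complete2 r d C}"

definition beta2 :: "nat \<Rightarrow> nat \<Rightarrow> nat" where
  "beta2 r d = Max {card B | B. nonblocking2 r d B}"

lemma subspace_F2: "F2.subspace (F2 r)"
  by (auto simp: F2.subspace_def F2_def scale2_def)

lemma F2_mono: "d \<le> r \<Longrightarrow> F2 d \<subseteq> F2 r"
  by (auto simp: F2_def)

definition unit2 :: "nat \<Rightarrow> nat \<Rightarrow> bit" where
  "unit2 i = (\<lambda>j. if j = i then 1 else 0)"

lemma inj_unit2: "inj unit2"
  by (auto simp: inj_def unit2_def fun_eq_iff split: if_splits)

lemma sum_fun_apply2: "(\<Sum>a\<in>A. (f a :: nat \<Rightarrow> bit)) j = (\<Sum>a\<in>A. f a j)"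
  by (induction A rule: infinite_finite_induct) auto

lemma sum_unit2:
  "(\<Sum>i<r. scale2 (c i) (unit2 i)) = (\<lambda>j. if j < r then c j else 0)"
  by (auto simp: fun_eq_iff sum_fun_apply2 scale2_def unit2_def if_distrib cong: if_cong)

lemma independent_unit2: "F2.independent (unit2 ` {..<r})"
proof (rule F2.independent_if_scalars_zero)
  fix f x assume 0: "(\<Sum>x\<in>unit2 ` {..<r}. scale2 (f x) x) = 0" and x: "x \<in> unit2 ` {..<r}"
  have "(\<Sum>i<r. scale2 (f (unit2 i)) (unit2 i)) = 0"
    using 0 by (subst (asm) sum.reindex) (auto intro: inj_on_subset[OF inj_unit2])
  then show "f x = 0"
    using x by (auto simp: sum_unit2 fun_eq_iff split: if_splits)
qed simp

lemma span_unit2: "F2.span (unit2 ` {..<r}) = F2 r"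
proof
  show "F2.span (unit2 ` {..<r}) \<subseteq> F2 r"
    by (rule F2.span_minimal) (auto simp: subspace_F2, auto simp: F2_def unit2_def)
  show "F2 r \<subseteq> F2.span (unit2 ` {..<r})"
  proof
    fix x assume "x \<in> F2 r"
    then have "x = (\<Sum>i<r. scale2 (x i) (unit2 i))"
      by (auto simp: sum_unit2 F2_def fun_eq_iff)
    also have "\<dots> \<in> F2.span (unit2 ` {..<r})"
      by (intro F2.span_sum F2.span_scale F2.span_base) auto
    finally show "x \<in> F2.span (unit2 ` {..<r})" .
  qed
qed

lemma dim_F2: "F2.dim (F2 r) = r"
proof -
  have "F2.dim (F2.span (unit2 ` {..<r})) = card (unit2 ` {..<r})"
    by (rule F2.dim_span_eq_card_independent[OF independent_unit2])
  also have "\<dots> = r"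
    by (subst card_image) (auto intro: inj_on_subset[OF inj_unit2])
  finally show ?thesis
    by (simp only: span_unit2)
qed

lemma card_F2: "finite (F2 r) \<and> card (F2 r) = 2 ^ r"
proof -
  have *: "bij_betw (\<lambda>A j. of_bool (j \<in> A) :: bit) (Pow {..<r}) (F2 r)"
    by (rule bij_betw_byWitness[where f' = "\<lambda>x. {j. x j = 1}"])
       (auto simp: F2_def fun_eq_iff intro: leI)
  show ?thesis
    using bij_betw_finite[OF *] bij_betw_same_card[OF *] by (simp add: card_Pow)
qed

lemma add_in_F2: "x \<in> F2 r \<Longrightarrow> y \<in> F2 r \<Longrightarrow> x + y \<in> F2 r"
  by (rule F2.subspace_add[OF subspace_F2])

lemma complete2_F2:
  assumes "d \<le> r" shows "complete2 r d (F2 r)"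
  unfolding complete2_def using assms F2_mono[OF assms] subspace_F2 dim_F2
  by (auto intro!: exI[of _ "F2 d"] add_in_F2)

lemma nonblocking2_empty: "nonblocking2 r d {}"
  unfolding nonblocking2_def using F2_mono[of "r - d" r] subspace_F2 dim_F2
  by (auto intro!: exI[of _ "F2 (r - d)"])

lemma gamma2_attained:
  assumes "d \<le> r"
  shows "\<exists>C. complete2 r d C \<and> card C = gamma2 r d"
    and "complete2 r d C \<Longrightarrow> gamma2 r d \<le> card C"
proof -
  have "finite {C. complete2 r d C}"
    by (rule finite_subset[of _ "Pow (F2 r)"]) (auto simp: complete2_def card_F2)
  then have fin: "finite {card C | C. complete2 r d C}"
    by simp
  moreover have "{card C | C. complete2 r d C} \<noteq> {}"
    using complete2_F2[OF assms] by blast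
  ultimately have "gamma2 r d \<in> {card C | C. complete2 r d C}"
    unfolding gamma2_def by (rule Min_in)
  then show "\<exists>C. complete2 r d C \<and> card C = gamma2 r d"
    by auto
  show "gamma2 r d \<le> card C" if "complete2 r d C"
    unfolding gamma2_def using fin that by (intro Min_le) auto
qed

lemma beta2_attained:
  shows "\<exists>B. nonblocking2 r d B \<and> card B = beta2 r d"
    and "nonblocking2 r d B \<Longrightarrow> card B \<le> beta2 r d"
proof -
  have "finite {B. nonblocking2 r d B}"
    by (rule finite_subset[of _ "Pow (F2 r)"]) (auto simp: nonblocking2_def card_F2)
  then have fin: "finite {card B | B. nonblocking2 r d B}"
    by simp
  moreover have "{card B | B. nonblocking2 r d B} \<noteq> {}"
    using nonblocking2_empty by blast
  ultimately have "beta2 r d \<in> {card B | B. nonblocking2 r d B}"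
    unfolding beta2_def by (rule Max_in)
  then show "\<exists>B. nonblocking2 r d B \<and> card B = beta2 r d"
    by auto
  show "card B \<le> beta2 r d" if "nonblocking2 r d B"
    unfolding beta2_def using fin that by (intro Max_ge) auto
qed

end

theory Submission
  imports Defs
begin

text \<open>
  Polynomial method. Let \<open>B\<close> be \<open>d\<close>-non-blocking. For \<open>v \<in> B\<close> the subspace \<open>L\<^sub>v\<close> is the
  common kernel of \<open>d\<close> linear functionals \<open>\<phi>\<^sub>1, \<dots>, \<phi>\<^sub>d\<close>, so \<open>P\<^sub>v(x) = \<Prod>\<^sub>i (1 + \<phi>\<^sub>i(x - v))\<close>
  is a polynomial of degree at most \<open>d\<close> which is the indicator function of \<open>v + L\<^sub>v\<close>; on \<open>B\<close>
  it is the indicator of \<open>v\<close>. Hence the \<open>P\<^sub>v\<close> are linearly independent. Since \<open>x\<^sub>i\<^sup>2 = x\<^sub>i\<close>, they lie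
  in the span of the square-free monomials of degree at most \<open>d\<close>, whose number is the bound.
  The bound for complete sets follows by complementation.
\<close>

text \<open>The same formula as \<open>scale2\<close>, but over an arbitrary domain, so that
  bit-valued functions on sequences form a vector space in which independence can be stated.\<close>

definition fscale2 :: "bit \<Rightarrow> ('a \<Rightarrow> bit) \<Rightarrow> ('a \<Rightarrow> bit)" where
  "fscale2 c f = (\<lambda>x. c * f x)"

global_interpretation F2fun: vector_space fscale2
  by unfold_locales (auto simp: fscale2_def fun_eq_iff algebra_simps)

lemma sum_fun_apply: "(\<Sum>a\<in>A. f a :: 'b \<Rightarrow> 'c :: comm_monoid_add) x = (\<Sum>a\<in>A. f a x)"
  by (induction A rule: infinite_finite_induct) auto

definition monomial2 :: "nat set \<Rightarrow> (nat \<Rightarrow> bit) \<Rightarrow> bit" where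
  "monomial2 S x = (\<Prod>i\<in>S. x i)"

text \<open>Polynomials of degree at most \<open>d\<close> in \<open>r\<close> variables, taken as
  functions rather than formal expressions; this lets square-free monomials suffice.\<close>

definition polyfun2 :: "nat \<Rightarrow> nat \<Rightarrow> ((nat \<Rightarrow> bit) \<Rightarrow> bit) set" where
  "polyfun2 r d = F2fun.span (monomial2 ` {S. S \<subseteq> {..<r} \<and> card S \<le> d})"

lemma subspace_polyfun2: "F2fun.subspace (polyfun2 r d)"
  by (simp add: polyfun2_def)

lemma polyfun2_mono: "d \<le> e \<Longrightarrow> polyfun2 r d \<subseteq> polyfun2 r e"
  unfolding polyfun2_def by (intro F2fun.span_mono) auto

lemma one_in_polyfun2: "(\<lambda>x. 1) \<in> polyfun2 r 0"
proof -
  have "monomial2 {} \<in> polyfun2 r 0"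
    unfolding polyfun2_def by (intro F2fun.span_base) auto
  then show ?thesis
    by (simp add: monomial2_def[abs_def])
qed

text \<open>Each bit is idempotent, so a repeated variable is absorbed. Multiplication by a variable
  thus stays within square-free monomials.\<close>

lemma monomial2_times_coord:
  assumes "finite S"
  shows "monomial2 S x * x i = monomial2 (insert i S) x"
proof (cases "i \<in> S")
  case True
  have "x i * x i = x i" by (cases "x i") auto
  then show ?thesis
    using True assms
    by (simp add: monomial2_def insert_absorb prod.remove[of S i] mult_ac mult.left_commute)
next
  case False
  then show ?thesis using assms by (simp add: monomial2_def mult_ac)
qed

lemma polyfun2_times_coord:
  assumes "f \<in> polyfun2 r d" "i < r"
  shows "(\<lambda>x. f x * x i) \<in> polyfun2 r (Suc d)"
  using assms(1) unfolding polyfun2_def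
proof (induction rule: F2fun.span_induct_alt)
  case base
  have "(\<lambda>x :: nat \<Rightarrow> bit. (0 :: (nat \<Rightarrow> bit) \<Rightarrow> bit) x * x i) = 0" by (simp add: fun_eq_iff)
  then show ?case by (metis F2fun.span_zero)
next
  case (step c m f)
  then obtain S where S: "S \<subseteq> {..<r}" "card S \<le> d" "m = monomial2 S" by auto
  then have fin: "finite S" by (auto intro: finite_subset)
  have eq: "(\<lambda>x. (fscale2 c m + f) x * x i)
      = fscale2 c (monomial2 (insert i S)) + (\<lambda>x. f x * x i)"
    by (auto simp: fun_eq_iff fscale2_def S(3) algebra_simps monomial2_times_coord[OF fin, symmetric])
  have "card (insert i S) \<le> Suc d"
    using S(2) fin by (simp add: card_insert_if)
  then have "monomial2 (insert i S) \<in> monomial2 ` {S. S \<subseteq> {..<r} \<and> card S \<le> Suc d}"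
    using S(1) assms(2) by auto
  then show ?case
    unfolding eq by (intro F2fun.span_add F2fun.span_scale F2fun.span_base step)
qed

lemma polyfun2_times_affine:
  assumes f: "f \<in> polyfun2 r d"
  shows "(\<lambda>x. f x * (c + (\<Sum>i<r. a i * x i))) \<in> polyfun2 r (Suc d)"
proof -
  have eq: "(\<lambda>x. f x * (c + (\<Sum>i<r. a i * x i)))
      = fscale2 c f + (\<Sum>i<r. fscale2 (a i) (\<lambda>x. f x * x i))"
  proof
    fix x
    show "f x * (c + (\<Sum>i<r. a i * x i))
        = (fscale2 c f + (\<Sum>i<r. fscale2 (a i) (\<lambda>x. f x * x i))) x"
      by (simp only: plus_fun_apply sum_fun_apply fscale2_def distrib_left sum_distrib_left mult_ac)
  qed
  have "f \<in> polyfun2 r (Suc d)" using f polyfun2_mono[of d "Suc d"] by auto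
  then show ?thesis
    unfolding eq using subspace_polyfun2 f
    by (intro F2fun.subspace_add F2fun.subspace_sum F2fun.subspace_scale polyfun2_times_coord)
       simp_all
qed

lemma prod_affine_in_polyfun2:
  assumes "finite D"
  shows "(\<lambda>x. \<Prod>b\<in>D. c b + (\<Sum>i<r. a b i * x i)) \<in> polyfun2 r (card D)"
  using assms
proof (induction D rule: finite_induct)
  case empty
  then show ?case by (simp add: one_in_polyfun2)
next
  case (insert b D)
  then show ?case
    using polyfun2_times_affine[OF insert.IH, of "c b" "a b"]
    by (simp only: prod.insert card_insert_disjoint mult.commute not_False_eq_True)
qed

lemma card_small_subsets:
  assumes "finite A"
  shows "card {S. S \<subseteq> A \<and> card S \<le> d} = (\<Sum>j\<le>d. card A choose j)"
proof -
  have "{S. S \<subseteq> A \<and> card S \<le> d} = (\<Union>j\<le>d. {S. S \<subseteq> A \<and> card S = j})" by auto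
  also have "card \<dots> = (\<Sum>j\<le>d. card {S. S \<subseteq> A \<and> card S = j})"
    using assms by (intro card_UN_disjoint) auto
  finally show ?thesis using assms by (simp add: n_subsets)
qed

text \<open>An independent set in the span of a finite set is no larger than that set, and the
  spanning monomials are indexed by the subsets of size at most \<open>d\<close>.\<close>

lemma independent_polyfun2_bound:
  assumes "F2fun.independent I" "I \<subseteq> polyfun2 r d"
  shows "card I \<le> (\<Sum>j\<le>d. r choose j)"
proof -
  let ?M = "{S. S \<subseteq> {..<r} \<and> card S \<le> d}"
  have fin: "finite ?M" by (rule finite_subset[of _ "Pow {..<r}"]) auto
  have "card I \<le> card (monomial2 ` ?M)"
    using F2fun.independent_span_bound[of "monomial2 ` ?M" I] assms fin
    by (auto simp: polyfun2_def)
  also have "\<dots> \<le> card ?M" by (rule card_image_le[OF fin])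
  finally show ?thesis by (simp add: card_small_subsets)
qed

text \<open>Extend a basis \<open>A\<close> of \<open>L\<close> to a basis \<open>A'\<close> of the
  whole space. The coordinates along \<open>A' - A\<close> are \<open>d\<close> linear functionals
  whose common kernel is \<open>L\<close>.\<close>

lemma subspace_indicator_polyfun2:
  assumes L: "F2.subspace L" "L \<subseteq> F2 r" "F2.dim L = r - d" and "d \<le> r" and v: "v \<in> F2 r"
  shows "\<exists>P\<in>polyfun2 r d. \<forall>x\<in>F2 r. P x = of_bool (x - v \<in> L)"
proof -
  obtain A where A: "A \<subseteq> L" "F2.independent A" "L \<subseteq> F2.span A" "card A = F2.dim L"
    by (rule F2.basis_exists)
  obtain A' where A': "A \<subseteq> A'" "A' \<subseteq> F2 r" "F2.independent A'" "F2 r \<subseteq> F2.span A'"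
    using F2.maximal_independent_subset_extend[OF order_trans[OF A(1) L(2)] A(2)] by blast
  have spanA: "F2.span A = L" using A L by (simp add: F2.span_minimal subset_antisym)
  have spanA': "F2.span A' = F2 r"
    using A' by (simp add: F2.span_minimal subset_antisym subspace_F2)
  have finA': "finite A'" using A'(2) card_F2 finite_subset by blast
  have "card A' = r"
    using F2.dim_span_eq_card_independent[OF A'(3)] by (simp add: spanA' dim_F2)
  \<comment> \<open>One factor of the product will come from each added basis vector, so this count
    is the degree bound.\<close>
  then have card: "card (A' - A) = d"
    using A(4) L(3) \<open>d \<le> r\<close> A'(1) finA' by (simp add: card_Diff_subset finite_subset)
  define \<phi> where "\<phi> b x = F2.representation A' x b" for b x
  have L_iff: "x \<in> L \<longleftrightarrow> (\<forall>b\<in>A' - A. \<phi> b x = 0)" if x: "x \<in> F2 r" for x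
  proof
    assume "x \<in> L"
    then have "x \<in> F2.span A" by (simp add: spanA)
    then have "F2.representation A' x = F2.representation A x"
      using F2.representation_extend[OF A'(3) _ A'(1)] by simp
    then show "\<forall>b\<in>A' - A. \<phi> b x = 0"
      using F2.representation_ne_zero unfolding \<phi>_def by fastforce
  next
    assume 0: "\<forall>b\<in>A' - A. \<phi> b x = 0"
    have "x = (\<Sum>b\<in>A'. scale2 (\<phi> b x) b)"
      using F2.sum_representation_eq[OF A'(3) _ finA' order_refl, of x] x
      by (simp add: spanA' \<phi>_def)
    also have "\<dots> = (\<Sum>b\<in>A. scale2 (\<phi> b x) b)"
      using 0 finA' A'(1) by (intro sum.mono_neutral_right) auto
    also have "\<dots> \<in> F2.span A"
      by (intro F2.span_sum F2.span_scale F2.span_base)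
    finally show "x \<in> L" by (simp add: spanA)
  qed
  have unit: "unit2 i \<in> F2 r" if "i < r" for i
    using that by (auto simp: F2_def unit2_def)
  \<comment> \<open>Rewrites the functional in standard coordinates, as a linear form in the
    variables \<open>x i\<close>. This holds on \<open>F2 r\<close> only, which is why
    \<open>P\<close> is evaluated there.\<close>
  have coord: "\<phi> b x = (\<Sum>i<r. \<phi> b (unit2 i) * x i)" if x: "x \<in> F2 r" for b x
  proof -
    have "x = (\<Sum>i<r. scale2 (x i) (unit2 i))"
      using x by (auto simp: sum_unit2 F2_def fun_eq_iff)
    then have "\<phi> b x = \<phi> b (\<Sum>i<r. scale2 (x i) (unit2 i))" by simp
    also have "\<dots> = (\<Sum>i<r. \<phi> b (scale2 (x i) (unit2 i)))"
      unfolding \<phi>_def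
      using unit by (subst F2.representation_sum[OF A'(3)])
        (auto simp: spanA' intro!: F2.subspace_scale[OF subspace_F2])
    also have "\<dots> = (\<Sum>i<r. \<phi> b (unit2 i) * x i)"
      unfolding \<phi>_def using unit
      by (intro sum.cong) (auto simp: F2.representation_scale[OF A'(3)] spanA')
    finally show ?thesis .
  qed
  \<comment> \<open>The translation by \<open>v\<close> goes into the constant term:
    \<open>1 + \<phi> b (x - v)\<close> equals \<open>(1 - \<phi> b v) + \<phi> b x\<close>.\<close>
  define P where "P x = (\<Prod>b\<in>A' - A. (1 - \<phi> b v) + (\<Sum>i<r. \<phi> b (unit2 i) * x i))" for x
  have "P \<in> polyfun2 r d"
    unfolding P_def[abs_def] card[symmetric] using finA'
    by (intro prod_affine_in_polyfun2 finite_Diff)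
  moreover have "P x = of_bool (x - v \<in> L)" if x: "x \<in> F2 r" for x
  proof -
    have xv: "x - v \<in> F2 r" using x v by (rule F2.subspace_diff[OF subspace_F2])
    have "\<phi> b (x - v) = \<phi> b x - \<phi> b v" for b
      using x v F2.representation_diff[OF A'(3)] by (simp add: \<phi>_def spanA')
    then have "P x = (\<Prod>b\<in>A' - A. 1 + \<phi> b (x - v))"
      by (simp only: P_def coord[OF x, symmetric] add_diff_eq diff_add_eq)
    \<comment> \<open>Over \<open>bit\<close>, \<open>1 + c\<close> is 1 for \<open>c = 0\<close>
      and 0 for \<open>c = 1\<close>, so one nonvanishing functional kills the product.\<close>
    also have "\<dots> = of_bool (\<forall>b\<in>A' - A. \<phi> b (x - v) = 0)"
    proof (cases "\<forall>b\<in>A' - A. \<phi> b (x - v) = 0")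
      case False
      then obtain b where "b \<in> A' - A" "1 + \<phi> b (x - v) = 0" by auto
      then have "(\<Prod>b\<in>A' - A. 1 + \<phi> b (x - v)) = 0"
        using finA' by (intro prod_zero) auto
      then show ?thesis using False by simp
    qed simp
    finally show ?thesis using L_iff[OF xv] by simp
  qed
  ultimately show ?thesis by blast
qed

lemma nonblocking2_card_le:
  assumes "nonblocking2 r d B" "d \<le> r"
  shows "card B \<le> (\<Sum>j\<le>d. r choose j)"
proof -
  have sub: "B \<subseteq> F2 r" and fin: "finite B"
    using assms card_F2 finite_subset by (auto simp: nonblocking2_def)
  have "\<exists>P\<in>polyfun2 r d. \<forall>x\<in>B. P x = of_bool (x = v)" if v: "v \<in> B" for v
  proof -
    have "v \<in> F2 r" using v sub by auto
    with assms(1) obtain L where L: "F2.subspace L" "L \<subseteq> F2 r" "F2.dim L = r - d"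
      and disj: "(\<lambda>x. v + x) ` (L - {0}) \<inter> B = {}"
      unfolding nonblocking2_def by blast
    obtain P where P: "P \<in> polyfun2 r d" "\<forall>x\<in>F2 r. P x = of_bool (x - v \<in> L)"
      using subspace_indicator_polyfun2[OF L assms(2) \<open>v \<in> F2 r\<close>] by blast
    \<comment> \<open>The translate of \<open>L\<close> by \<open>v\<close> meets \<open>B\<close>
      in \<open>v\<close> alone: 0 contributes \<open>v\<close> itself, and \<open>disj\<close>
      excludes the rest.\<close>
    have mem: "x - v \<in> L \<longleftrightarrow> x = v" if "x \<in> B" for x
    proof
      assume "x - v \<in> L"
      show "x = v"
      proof (rule ccontr)
        assume "x \<noteq> v"
        then have "v + (x - v) \<in> (\<lambda>x. v + x) ` (L - {0})"
          using \<open>x - v \<in> L\<close> by (intro imageI) (metis Diff_iff eq_iff_diff_eq_0 singletonD)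
        then show False using disj that by (simp only: add_diff_eq add_diff_cancel_left') blast
      qed
    qed (simp add: F2.subspace_0[OF L(1)])
    have "P x = of_bool (x = v)" if "x \<in> B" for x
      unfolding mem[OF that, symmetric] using P(2) sub that by blast
    then show ?thesis using P(1) by blast
  qed
  then obtain P where P: "\<And>v. v \<in> B \<Longrightarrow> P v \<in> polyfun2 r d"
    and ind: "\<And>v x. v \<in> B \<Longrightarrow> x \<in> B \<Longrightarrow> P v x = of_bool (x = v)"
    by metis
  have inj: "inj_on P B"
  proof (rule inj_onI)
    fix v w assume "v \<in> B" "w \<in> B" "P v = P w"
    then have "P w v = 1" using ind[of v v] by simp
    then show "v = w" using ind[of w v] \<open>v \<in> B\<close> \<open>w \<in> B\<close> by (simp split: if_splits)
  qed
  have zero: "g f = 0" if 0: "(\<Sum>f\<in>P ` B. fscale2 (g f) f) = 0" and f: "f \<in> P ` B" for g f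
  proof -
    obtain v where v: "v \<in> B" "f = P v" using f by auto
    have eval: "(\<Sum>w\<in>A. fscale2 (g (P w)) (P w)) x = (\<Sum>w\<in>A. g (P w) * P w x)" for A x
      by (simp only: sum_fun_apply fscale2_def)
    \<comment> \<open>Evaluating the linear relation at the point \<open>v\<close> isolates the
      coefficient of \<open>P v\<close>.\<close>
    have "0 = (\<Sum>w\<in>B. fscale2 (g (P w)) (P w)) v"
      using 0 by (simp add: sum.reindex[OF inj])
    also have "\<dots> = (\<Sum>w\<in>B. if w = v then g f else 0)"
      unfolding eval using v ind by (intro sum.cong) auto
    also have "\<dots> = g f" using v fin by simp
    finally show "g f = 0" by simp
  qed
  have "F2fun.independent (P ` B)"
    unfolding F2fun.dependent_finite[OF finite_imageI[OF fin]] using zero by blast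
  moreover have "P ` B \<subseteq> polyfun2 r d" using P by (rule image_subsetI)
  ultimately have "card (P ` B) \<le> (\<Sum>j\<le>d. r choose j)"
    by (rule independent_polyfun2_bound)
  then show ?thesis by (simp add: card_image[OF inj])
qed

text \<open>The same subspace serves for both notions: containment in \<open>C\<close> is
  disjointness from the complement, and \<open>d \<le> r\<close> gives
  \<open>r - (r - d) = d\<close>.\<close>

lemma complete2_complement:
  assumes "complete2 r d C" "d \<le> r"
  shows "nonblocking2 r (r - d) (F2 r - C)"
  unfolding nonblocking2_def
proof (intro conjI ballI)
  fix v assume "v \<in> F2 r"
  then obtain L where "F2.subspace L" "L \<subseteq> F2 r" "F2.dim L = d" "(\<lambda>x. v + x) ` (L - {0}) \<subseteq> C"
    using assms(1) unfolding complete2_def by blast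
  then show "\<exists>L. F2.subspace L \<and> L \<subseteq> F2 r \<and> F2.dim L = r - (r - d) \<and>
      (\<lambda>x. v + x) ` (L - {0}) \<inter> (F2 r - C) = {}"
    using assms(2) by (intro exI[of _ L]) auto
qed auto

text \<open>The symmetry \<open>j \<mapsto> r - j\<close> turns the second sum into the binomials
  from \<open>d\<close> to \<open>r\<close>, which complete the row.\<close>

lemma sum_choose_upper_lower:
  assumes "d \<le> (r :: nat)"
  shows "(\<Sum>j<d. r choose j) + (\<Sum>j\<le>r - d. r choose j) = 2 ^ r"
proof -
  have "(\<Sum>j\<le>r - d. r choose j) = (\<Sum>j\<in>{d..r}. r choose j)"
    by (rule sum.reindex_bij_witness[of _ "\<lambda>j. r - j" "\<lambda>j. r - j"])
       (use assms in \<open>auto simp: binomial_symmetric[symmetric]\<close>)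
  moreover have "{..r} = {..<d} \<union> {d..r}" using assms by auto
  then have "(\<Sum>j\<le>r. r choose j) = (\<Sum>j<d. r choose j) + (\<Sum>j\<in>{d..r}. r choose j)"
    by (simp add: sum.union_disjoint ivl_disj_int)
  ultimately show ?thesis by (simp add: choose_row_sum)
qed

lemma complete2_card_ge:
  assumes "complete2 r d C" "d \<le> r"
  shows "(\<Sum>j<d. r choose j) \<le> card C"
proof -
  have sub: "C \<subseteq> F2 r" using assms by (simp add: complete2_def)
  then have "2 ^ r - card C = card (F2 r - C)"
    using card_F2[of r] by (simp add: card_Diff_subset finite_subset)
  also have "\<dots> \<le> (\<Sum>j\<le>r - d. r choose j)"
    by (rule nonblocking2_card_le[OF complete2_complement[OF assms]]) simp
  finally show ?thesis using sum_choose_upper_lower[OF assms(2)] by linarith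
qed

theorem theorem4:
  "(\<forall>r d :: nat. d \<le> r \<longrightarrow> gamma2 r d \<ge> (\<Sum>j<d. r choose j)) \<and>
   (\<forall>r d :: nat. d \<le> r \<longrightarrow> beta2 r d \<le> (\<Sum>j\<le>d. r choose j))"
proof (intro conjI allI impI)
  fix r d :: nat assume "d \<le> r"
  show "gamma2 r d \<ge> (\<Sum>j<d. r choose j)"
    \<comment> \<open>The extremum is attained, so the bound for individual sets applies to it;
      likewise for \<open>beta2\<close>.\<close>
    using gamma2_attained(1)[OF \<open>d \<le> r\<close>] complete2_card_ge[OF _ \<open>d \<le> r\<close>] by fastforce
  show "beta2 r d \<le> (\<Sum>j\<le>d. r choose j)"
    using beta2_attained(1)[of r d] nonblocking2_card_le[OF _ \<open>d \<le> r\<close>] by fastforce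
qed

end
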